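(* Consider the online label learning algorithm described in the context, run on images arriving one at a time, for solving the max-min problem $$\max_{\rho_j\ge 0}\ \min_{p_i\in\Delta}\ \frac1n\sum_{i=1}^n D_{KL}(p_i\|q_i)-\sum_{j=1}^C\rho_j\Big(\frac1n\sum_{i=1}^n p_{i,j}-\frac{\alpha}{C}\Big),$$ with step size $\eta_\rho^i=c_\rho/\sqrt{i}$, where $c_\rho$ is a constant. Let $p_i^*$ and $\rho^i$ be the iterates it produces, and let $\mathcal{L}_i(\rho,p)$ be the per-example Lagrangian defined in the context. Then the convergence is guaranteed as $$\frac{1}{n}\left(\max_{\rho}\ \sum_{i=1}^n \mathcal{L}_i(\rho,p_i^* )\;-\;\min_{p_1,\dots,p_n}\ \sum_{i=1}^n \mathcal{L}_i(\rho^{i-1},p_i)\right)\le \mathcal{O}\Big(\frac{1}{\sqrt{n}}\Big),$$ where the maximum is over dual variables $\rho=(\rho_1,\dots,\rho_C)$ with $\rho_j\ge 0$ for all $j$, and the minimum is over $p_i\in\Delta$.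
   Context: $C$ is the number of classes, $n$ the number of images, and $\alpha\in[0,1]$. $\Delta=\{p\in\mathbb{R}^C : \sum_{j=1}^C p_j=1,\ p_j\ge 0\ \forall j\}$ is the probability simplex, and $D_{KL}(p\|q)=\sum_{j=1}^C p_j\log(p_j/q_j)$ is the Kullback-Leibler divergence. Let $z_1,\dots,z_C\in\mathbb{R}^d$ be class (text) proxies, $x_i\in\mathbb{R}^d$ the representation of the $i$-th arriving image, and $\tau_T>0$ a temperature. For each $i$, $q_i\in\Delta$ is given by $$q_{i,j}=\frac{\exp(x_i^\top z_j/\tau_T)}{\sum_{k=1}^C\exp(x_i^\top z_k/\tau_T)},\qquad j=1,\dots,C.$$ The max-min problem is the Lagrangian form, with dual variables $\rho_j\ge 0$, of: minimize $\frac1n\sum_i D_{KL}(p_i\|q_i)$ over $p_i\in\Delta$ subject to $\frac1n\sum_i p_{i,j}\ge\alpha/C$ for all $j$. The per-example Lagrangian is $$\mathcal{L}_i(\rho,p)=D_{KL}(p\|q_i)-\sum_{j=1}^C\rho_j\Big(p_j-\frac{\alpha}{C}\Big).$$ Online label learning algorithm: initialize $\rho^0_j=0$ for all $j$. When the $i$-th image arrives ($i=1,2,\dots$), set, for $j=1,\dots,C$, $$p_{i,j}^*=\frac{q_{i,j}\exp(\rho_j^{i-1})}{\sum_{k=1}^C q_{i,k}\exp(\rho_k^{i-1})},\qquad \rho_j^i=\max\{0,\ \rho_j^{i-1}-\eta_\rho^i(p_{i,j}^*-\alpha/C)\},$$ where $\eta_\rho^i$ is the step size (learning rate) for the dual 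variables.
   Formalization: The maximum over all ρ ≥ 0 can be +∞, so the bound is for ρ ≥ 0 with |ρ| ≤ R (any R), and for all ρ ≥ 0 when that maximum is finite; image representations satisfy |x_i| ≤ B (any B), as the claim fails for unbounded ones; c_ρ > 0; the constant depends on R and B. *)

theory Defs
  imports "HOL-Analysis.Analysis"
begin

text \<open>Classes are the elements of a finite type \<open>'c\<close> (so \<open>C = CARD('c)\<close>) and features live in
  \<open>real ^ 'd\<close>. Images are numbered from 1; \<open>x 0\<close> is never used.\<close>

definition prob_simplex :: "(real ^ 'c::finite) set" where
  "prob_simplex = {p. (\<Sum>j\<in>UNIV. p $ j) = 1 \<and> (\<forall>j. 0 \<le> p $ j)}"

definition dual_vars :: "(real ^ 'c::finite) set" where
  "dual_vars = {\<rho>. \<forall>j. 0 \<le> \<rho> $ j}"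

text \<open>The convention \<open>0 log 0 = 0\<close> holds because of the factor \<open>p $ j\<close>; \<open>q\<close> will always have
  positive entries.\<close>

definition KL :: "real ^ 'c::finite \<Rightarrow> real ^ 'c \<Rightarrow> real" where
  "KL p q = (\<Sum>j\<in>UNIV. p $ j * ln (p $ j / q $ j))"

definition class_probs :: "('c::finite \<Rightarrow> real ^ 'd) \<Rightarrow> real \<Rightarrow> real ^ 'd::finite \<Rightarrow> real ^ 'c" where
  "class_probs z \<tau> v =
     (\<chi> j. exp ((v \<bullet> z j) / \<tau>) / (\<Sum>k\<in>UNIV. exp ((v \<bullet> z k) / \<tau>)))"

definition lagrangian :: "real \<Rightarrow> real ^ 'c::finite \<Rightarrow> real ^ 'c \<Rightarrow> real ^ 'c \<Rightarrow> real" where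
  "lagrangian \<alpha> q \<rho> p = KL p q - (\<Sum>j\<in>UNIV. \<rho> $ j * (p $ j - \<alpha> / real CARD('c)))"

definition primal_step :: "real ^ 'c::finite \<Rightarrow> real ^ 'c \<Rightarrow> real ^ 'c" where
  "primal_step q \<rho> = (\<chi> j. q $ j * exp (\<rho> $ j) / (\<Sum>k\<in>UNIV. q $ k * exp (\<rho> $ k)))"

definition dual_step :: "real \<Rightarrow> real \<Rightarrow> real ^ 'c::finite \<Rightarrow> real ^ 'c \<Rightarrow> real ^ 'c" where
  "dual_step \<alpha> s p \<rho> = (\<chi> j. max 0 (\<rho> $ j - s * (p $ j - \<alpha> / real CARD('c))))"

text \<open>In the iterates below, \<open>q i\<close> is the class distribution of the \<open>i\<close>-th image and \<open>\<eta> i\<close> the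
  step size used when it arrives.\<close>

primrec dual_iter ::
  "real \<Rightarrow> (nat \<Rightarrow> real) \<Rightarrow> (nat \<Rightarrow> real ^ 'c::finite) \<Rightarrow> nat \<Rightarrow> real ^ 'c" where
  "dual_iter \<alpha> \<eta> q 0 = 0"
| "dual_iter \<alpha> \<eta> q (Suc i) =
     dual_step \<alpha> (\<eta> (Suc i)) (primal_step (q (Suc i)) (dual_iter \<alpha> \<eta> q i)) (dual_iter \<alpha> \<eta> q i)"

definition primal_iter ::
  "real \<Rightarrow> (nat \<Rightarrow> real) \<Rightarrow> (nat \<Rightarrow> real ^ 'c::finite) \<Rightarrow> nat \<Rightarrow> real ^ 'c" where
  "primal_iter \<alpha> \<eta> q i = primal_step (q i) (dual_iter \<alpha> \<eta> q (i - 1))"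

text \<open>The two extremal values are taken in \<^typ>\<open>ereal\<close>, where they always exist. This matters for
  the first one: it is linear in \<open>\<rho>\<close> and is \<open>\<infinity>\<close> over all of \<^const>\<open>dual_vars\<close> as soon as some
  class receives less than its share \<open>\<alpha> / C\<close> on average. Over a compact nonempty \<open>S\<close>, the supremum
  is a maximum; the infimum is always a minimum.\<close>

definition max_lagrangian ::
  "real \<Rightarrow> (nat \<Rightarrow> real) \<Rightarrow> (nat \<Rightarrow> real ^ 'c::finite) \<Rightarrow> nat \<Rightarrow> (real ^ 'c) set \<Rightarrow> ereal" where
  "max_lagrangian \<alpha> \<eta> q n S =
     (SUP \<rho>\<in>S. ereal (\<Sum>i=1..n. lagrangian \<alpha> (q i) \<rho> (primal_iter \<alpha> \<eta> q i)))"

definition min_lagrangian ::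
  "real \<Rightarrow> (nat \<Rightarrow> real) \<Rightarrow> (nat \<Rightarrow> real ^ 'c::finite) \<Rightarrow> nat \<Rightarrow> ereal" where
  "min_lagrangian \<alpha> \<eta> q n =
     (INF P\<in>{P. \<forall>i\<in>{1..n}. P i \<in> prob_simplex}.
        ereal (\<Sum>i=1..n. lagrangian \<alpha> (q i) (dual_iter \<alpha> \<eta> q (i - 1)) (P i)))"

end

theory Submission
  imports Defs
begin

text \<open>
  By Gibbs' inequality the primal iterate minimises the Lagrangian at the current dual variable, so
  the duality gap is the regret of projected gradient steps on linear losses, whose telescoping
  bound is of order \<open>\<surd>n\<close> provided that the dual iterates stay bounded. They do because the step
  contracts the spread of \<open>\<rho>\<close> around its mean: the primal iterate concentrates on the classes with
  large \<open>\<rho>\<close>, up to an error \<open>- ln \<delta>\<close> where \<open>\<delta>\<close> bounds all class probabilities from below. The mean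
  itself does not increase under the unprojected step, and whenever the projection acts, some
  coordinate vanishes, so that the mean is at most the spread.
\<close>

section \<open>The primal step\<close>

text \<open>Gibbs' inequality: \<open>ln t \<le> t - 1\<close> at \<open>t = q $ j / p $ j\<close>
  bounds each summand below by \<open>p $ j - q $ j\<close>, and these differences sum to
  zero.\<close>

lemma KL_ge_zero:
  fixes p q :: "real ^ 'c::finite"
  assumes "p \<in> prob_simplex" "q \<in> prob_simplex" and pos: "\<And>j. 0 < q $ j"
  shows "0 \<le> KL p q"
proof -
  have "p $ j - q $ j \<le> p $ j * ln (p $ j / q $ j)" for j
  proof (cases "p $ j = 0")
    case True
    then show ?thesis using pos[of j] by simp
  next
    case False
    then have p: "0 < p $ j" using assms(1) by (simp add: prob_simplex_def less_le)
    have "1 - q $ j / p $ j \<le> ln (p $ j / q $ j)"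
      using ln_le_minus_one[of "q $ j / p $ j"] p pos[of j] by (simp add: ln_div)
    from mult_left_mono[OF this, of "p $ j"] show ?thesis
      using p by (simp add: right_diff_distrib)
  qed
  then have "(\<Sum>j\<in>UNIV. p $ j - q $ j) \<le> KL p q"
    unfolding KL_def by (intro sum_mono) auto
  then show ?thesis using assms(1,2) by (simp add: sum_subtractf prob_simplex_def)
qed

lemma partition_function_pos:
  fixes q \<rho> :: "real ^ 'c::finite"
  assumes "\<And>j. 0 < q $ j"
  shows "0 < (\<Sum>k\<in>UNIV. q $ k * exp (\<rho> $ k))"
  using assms by (intro sum_pos) auto

lemma primal_step_pos:
  fixes q :: "real ^ 'c::finite"
  assumes "\<And>j. 0 < q $ j"
  shows "0 < primal_step q \<rho> $ j"
  using assms partition_function_pos[OF assms] by (simp add: primal_step_def)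

lemma primal_step_in_simplex:
  fixes q :: "real ^ 'c::finite"
  assumes "\<And>j. 0 < q $ j"
  shows "primal_step q \<rho> \<in> prob_simplex"
proof -
  have "(\<Sum>j\<in>UNIV. primal_step q \<rho> $ j) = 1"
    using partition_function_pos[OF assms, where \<rho>=\<rho>]
    by (simp add: primal_step_def flip: sum_divide_distrib)
  then show ?thesis
    using primal_step_pos[OF assms, where \<rho>=\<rho>] by (auto simp: prob_simplex_def intro: less_imp_le)
qed

text \<open>Gibbs variational identity: \<open>primal_step q \<rho>\<close> is \<open>q\<close>
  tilted by \<open>exp \<rho>\<close> and normalised, so its logarithm differs from that of
  \<open>q\<close> by \<open>\<rho>\<close> minus the log partition function. On the right,
  \<open>p\<close> occurs only in a divergence.\<close>

lemma KL_tilt: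
  fixes p q :: "real ^ 'c::finite"
  assumes p: "p \<in> prob_simplex" and pos: "\<And>j. 0 < q $ j"
  shows "KL p q - \<rho> \<bullet> p = KL p (primal_step q \<rho>) - ln (\<Sum>k\<in>UNIV. q $ k * exp (\<rho> $ k))"
proof -
  define Z where "Z = (\<Sum>k\<in>UNIV. q $ k * exp (\<rho> $ k))"
  have Z: "0 < Z" unfolding Z_def by (rule partition_function_pos[OF pos])
  have "p $ j * ln (p $ j / q $ j) - \<rho> $ j * p $ j
      = p $ j * ln (p $ j / primal_step q \<rho> $ j) - p $ j * ln Z" for j
  proof (cases "p $ j = 0")
    case False
    then have "0 < p $ j" using p by (simp add: prob_simplex_def less_le)
    then show ?thesis using Z pos[of j]
      by (simp add: primal_step_def ln_div ln_mult algebra_simps flip: Z_def)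
  qed simp
  then have "KL p q - \<rho> \<bullet> p = KL p (primal_step q \<rho>) - (\<Sum>j\<in>UNIV. p $ j * ln Z)"
    by (simp add: KL_def inner_vec_def flip: sum_subtractf)
  also have "(\<Sum>j\<in>UNIV. p $ j * ln Z) = ln Z"
    using p by (simp add: prob_simplex_def flip: sum_distrib_right)
  finally show ?thesis by (simp add: Z_def)
qed

lemma KL_self: "KL p p = 0"
  unfolding KL_def by (intro sum.neutral) auto

text \<open>By \<open>KL_tilt\<close> at the primal step itself, the right-hand side is the log
  partition function plus a nonnegative divergence, and the partition function is at least its
  \<open>j\<close>-th term. This is the concentration on large coordinates of \<rho>.\<close>

lemma primal_step_tilted_mean_ge:
  fixes q \<rho> :: "real ^ 'c::finite"
  assumes q: "q \<in> prob_simplex" and pos: "\<And>j. 0 < q $ j"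
  shows "\<rho> $ j + ln (q $ j) \<le> \<rho> \<bullet> primal_step q \<rho>"
proof -
  define Z where "Z = (\<Sum>k\<in>UNIV. q $ k * exp (\<rho> $ k))"
  let ?p = "primal_step q \<rho>"
  have "q $ j * exp (\<rho> $ j) \<le> Z"
    unfolding Z_def using pos by (intro member_le_sum) (auto intro: less_imp_le)
  then have "ln (q $ j * exp (\<rho> $ j)) \<le> ln Z"
    using pos[of j] by (intro ln_mono) auto
  moreover have "KL ?p q - \<rho> \<bullet> ?p = - ln Z"
    using KL_tilt[OF primal_step_in_simplex[OF pos] pos, of \<rho> \<rho>] by (simp add: KL_self Z_def)
  moreover have "0 \<le> KL ?p q"
    by (rule KL_ge_zero[OF primal_step_in_simplex[OF pos] q pos])
  ultimately show ?thesis using pos[of j] by (simp add: ln_mult)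
qed

text \<open>Minus the gradient of the Lagrangian in \<rho>, so that the dual step is projected
  gradient ascent.\<close>

definition excess :: "real \<Rightarrow> real ^ 'c::finite \<Rightarrow> real ^ 'c" where
  "excess \<alpha> p = p - vec (\<alpha> / real CARD('c))"

lemma lagrangian_eq: "lagrangian \<alpha> q \<rho> p = KL p q - \<rho> \<bullet> excess \<alpha> p"
  by (simp add: lagrangian_def excess_def inner_vec_def)

lemma lagrangian_primal_step_le:
  fixes q :: "real ^ 'c::finite"
  assumes p: "p \<in> prob_simplex" and pos: "\<And>j. 0 < q $ j"
  shows "lagrangian \<alpha> q \<rho> (primal_step q \<rho>) \<le> lagrangian \<alpha> q \<rho> p"
proof -
  note s = primal_step_in_simplex[OF pos, where \<rho>=\<rho>]
  have "0 \<le> KL p (primal_step q \<rho>)"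
    by (rule KL_ge_zero[OF p s primal_step_pos[OF pos]])
  then show ?thesis
    using KL_tilt[OF p pos, of \<rho>] KL_tilt[OF s pos, of \<rho>]
    by (simp add: lagrangian_eq excess_def inner_diff_right KL_self)
qed

section \<open>The dual step\<close>

lemma sum_excess:
  fixes p :: "real ^ 'c::finite"
  assumes "p \<in> prob_simplex"
  shows "(\<Sum>j\<in>UNIV. excess \<alpha> p $ j) = 1 - \<alpha>"
  using assms by (simp add: excess_def prob_simplex_def sum_subtractf)

lemma norm_excess_le:
  fixes p :: "real ^ 'c::finite"
  assumes p: "p \<in> prob_simplex" and "0 \<le> \<alpha>" "\<alpha> \<le> 1"
  shows "norm (excess \<alpha> p) \<le> 2"
proof -
  have "norm (excess \<alpha> p) \<le> (\<Sum>j\<in>UNIV. \<bar>excess \<alpha> p $ j\<bar>)"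
    by (rule norm_le_l1_cart)
  also have "\<dots> \<le> (\<Sum>j\<in>UNIV. p $ j + \<alpha> / real CARD('c))"
  proof (rule sum_mono)
    fix j
    have "0 \<le> p $ j" "0 \<le> \<alpha> / real CARD('c)" using assms by (auto simp: prob_simplex_def)
    then show "\<bar>excess \<alpha> p $ j\<bar> \<le> p $ j + \<alpha> / real CARD('c)"
      unfolding excess_def by (simp only: vector_minus_component vec_component)
  qed
  also have "\<dots> = 1 + \<alpha>" using p by (simp add: sum.distrib prob_simplex_def)
  finally show ?thesis using assms(3) by simp
qed

lemma dual_step_component: "dual_step \<alpha> s p \<rho> $ j = max 0 (\<rho> $ j - s * excess \<alpha> p $ j)"
  by (simp add: dual_step_def excess_def)

lemma dual_step_in_dual_vars: "dual_step \<alpha> s p \<rho> \<in> dual_vars"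
  by (simp add: dual_vars_def dual_step_component)

text \<open>Truncation at 0 is the projection onto the orthant: coordinate by coordinate, it cannot
  move away from a nonnegative number.\<close>

lemma norm_dual_step_diff_le:
  fixes u :: "real ^ 'c::finite"
  assumes "u \<in> dual_vars"
  shows "norm (dual_step \<alpha> s p \<rho> - u) \<le> norm (\<rho> - u - s *\<^sub>R excess \<alpha> p)"
proof (rule norm_le_componentwise_cart)
  fix j
  have "0 \<le> u $ j" using assms by (simp add: dual_vars_def)
  then show "norm ((dual_step \<alpha> s p \<rho> - u) $ j) \<le> norm ((\<rho> - u - s *\<^sub>R excess \<alpha> p) $ j)"
    by (simp add: dual_step_component)
qed

text \<open>The one-step inequality of projected gradient methods. It serves twice: with a constant
  vector as \<open>u\<close> for boundedness, and with a comparator as \<open>u\<close> for the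
  regret.\<close>

lemma power2_norm_dual_step_diff_le:
  fixes u :: "real ^ 'c::finite"
  assumes "u \<in> dual_vars" "p \<in> prob_simplex" "0 \<le> \<alpha>" "\<alpha> \<le> 1"
  shows "(norm (dual_step \<alpha> s p \<rho> - u))\<^sup>2
    \<le> (norm (\<rho> - u))\<^sup>2 - 2 * s * ((\<rho> - u) \<bullet> excess \<alpha> p) + 4 * s\<^sup>2"
proof -
  have "(norm (dual_step \<alpha> s p \<rho> - u))\<^sup>2 \<le> (norm (\<rho> - u - s *\<^sub>R excess \<alpha> p))\<^sup>2"
    using norm_dual_step_diff_le[OF assms(1)] by (intro power_mono) auto
  also have "\<dots> = (norm (\<rho> - u))\<^sup>2 - 2 * s * ((\<rho> - u) \<bullet> excess \<alpha> p) + s\<^sup>2 * (norm (excess \<alpha> p))\<^sup>2"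
    unfolding power2_norm_eq_inner
    by (simp add: inner_diff_left inner_diff_right inner_commute power2_eq_square algebra_simps)
  also have "s\<^sup>2 * (norm (excess \<alpha> p))\<^sup>2 \<le> s\<^sup>2 * 2\<^sup>2"
    using norm_excess_le[OF assms(2-4)] by (intro mult_left_mono power_mono) auto
  finally show ?thesis by simp
qed

section \<open>Boundedness of the dual iterates\<close>

definition mean :: "real ^ 'c::finite \<Rightarrow> real" where
  "mean \<rho> = (\<Sum>j\<in>UNIV. \<rho> $ j) / real CARD('c)"

text \<open>The orthogonal projection onto the vectors of sum zero; its norm is the spread.\<close>

definition centered :: "real ^ 'c::finite \<Rightarrow> real ^ 'c" where
  "centered \<rho> = \<rho> - vec (mean \<rho>)"

lemma sum_centered: "(\<Sum>j\<in>UNIV. centered \<rho> $ j) = 0"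
  by (simp add: centered_def mean_def sum_subtractf)

lemma centered_inner_vec: "centered \<rho> \<bullet> vec a = 0"
  using sum_centered[of \<rho>] by (simp add: inner_vec_def flip: sum_distrib_right)

text \<open>By Pythagoras the mean is the best constant approximation. A new iterate may therefore
  be compared with the old mean.\<close>

lemma norm_centered_le: "norm (centered \<rho>) \<le> norm (\<rho> - vec t)"
proof -
  have "(norm (\<rho> - vec t))\<^sup>2 = (norm (centered \<rho> + vec (mean \<rho> - t)))\<^sup>2"
    by (simp add: centered_def vec_sub)
  also have "\<dots> = (norm (centered \<rho>))\<^sup>2 + (norm (vec (mean \<rho> - t) :: real ^ 'a))\<^sup>2"
    by (intro norm_add_Pythagorean) (simp add: orthogonal_def centered_inner_vec)
  finally have "(norm (centered \<rho>))\<^sup>2 \<le> (norm (\<rho> - vec t))\<^sup>2" by simp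
  then show ?thesis by (rule power2_le_imp_le) simp
qed

text \<open>Since the coordinates sum to zero, the largest one also controls the negative ones, and
  hence the whole norm.\<close>

lemma norm_centered_le_coordinate:
  fixes \<rho> :: "real ^ 'c::finite"
  obtains j where "norm (centered \<rho>) \<le> 2 * real CARD('c) * centered \<rho> $ j"
proof -
  let ?y = "centered \<rho>"
  define M where "M = Max (range (\<lambda>j. ?y $ j))"
  have "M \<in> range (\<lambda>j. ?y $ j)" unfolding M_def by (intro Max_in) auto
  then obtain j where j: "M = ?y $ j" by auto
  have le: "?y $ k \<le> M" for k unfolding M_def by (intro Max_ge) auto
  have "0 \<le> M"
  proof (rule ccontr)
    assume "\<not> 0 \<le> M"
    then have "?y $ k < 0" for k using le[of k] by linarith
    then have "(\<Sum>k\<in>UNIV. ?y $ k) < (\<Sum>k\<in>(UNIV :: 'c set). 0)"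
      by (intro sum_strict_mono) auto
    then show False by (simp add: sum_centered)
  qed
  have "norm ?y \<le> (\<Sum>k\<in>UNIV. \<bar>?y $ k\<bar>)" by (rule norm_le_l1_cart)
  \<comment> \<open>For \<open>y \<ge> 0\<close> this says \<open>2 * y \<le> 2 * M\<close>; for
    \<open>y < 0\<close> it says \<open>0 \<le> 2 * M\<close>.\<close>
  also have "\<dots> \<le> (\<Sum>k\<in>UNIV. 2 * M - ?y $ k)"
    using le \<open>0 \<le> M\<close> by (intro sum_mono) (smt (verit))
  also have "\<dots> = 2 * real CARD('c) * ?y $ j" by (simp add: sum_subtractf sum_centered j)
  finally show ?thesis by (rule that)
qed

lemma mean_le_norm_centered:
  fixes \<rho> :: "real ^ 'c::finite"
  assumes "\<rho> $ j = 0"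
  shows "mean \<rho> \<le> norm (centered \<rho>)"
  using component_le_norm_cart[of "centered \<rho>" j] assms by (simp add: centered_def)

text \<open>The drift towards the mean: apply the concentration of the primal step at a coordinate
  that controls the spread, where \<open>ln (q $ j)\<close> costs at most
  \<open>- ln \<delta>\<close>.\<close>

lemma centered_inner_excess_ge:
  fixes q \<rho> :: "real ^ 'c::finite"
  assumes q: "q \<in> prob_simplex" and "0 < \<delta>" and lower: "\<And>j. \<delta> \<le> q $ j"
  shows "norm (centered \<rho>) / (2 * real CARD('c)) + ln \<delta>
    \<le> centered \<rho> \<bullet> excess \<alpha> (primal_step q \<rho>)"
proof -
  have pos: "0 < q $ j" for j using \<open>0 < \<delta>\<close> lower[of j] by linarith
  obtain j where j: "norm (centered \<rho>) \<le> 2 * real CARD('c) * centered \<rho> $ j"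
    by (rule norm_centered_le_coordinate)
  let ?p = "primal_step q \<rho>"
  have "norm (centered \<rho>) / (2 * real CARD('c)) \<le> centered \<rho> $ j"
    using j by (simp add: divide_le_eq mult.commute)
  moreover have "ln \<delta> \<le> ln (q $ j)" using \<open>0 < \<delta>\<close> lower[of j] pos[of j] by simp
  moreover have "\<rho> $ j + ln (q $ j) \<le> \<rho> \<bullet> ?p" by (rule primal_step_tilted_mean_ge[OF q pos])
  \<comment> \<open>The constant part of \<open>excess\<close> is orthogonal to centered vectors,
    and \<open>?p\<close> has total mass 1.\<close>
  moreover have "centered \<rho> \<bullet> excess \<alpha> ?p = \<rho> \<bullet> ?p - mean \<rho>"
  proof -
    have "vec (mean \<rho>) \<bullet> ?p = mean \<rho>"
      using primal_step_in_simplex[OF pos, of \<rho>]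
      by (simp add: inner_vec_def prob_simplex_def flip: sum_distrib_left)
    then show ?thesis
      by (simp add: excess_def inner_diff_right centered_inner_vec) (simp add: centered_def inner_diff_left)
  qed
  ultimately show ?thesis by (simp add: centered_def)
qed

text \<open>Beyond the first summand the spread cannot increase when the step size is at most \<open>c\<close>; the
  second one is the length of a single step.\<close>

definition spread_bound :: "nat \<Rightarrow> real \<Rightarrow> real \<Rightarrow> real" where
  "spread_bound m c \<delta> = 2 * real m * (2 * c - ln \<delta>) + 2 * c"

text \<open>Below the threshold a step adds at most \<open>2 * c\<close> to the spread; above it,
  the drift outweighs the quadratic error of the step.\<close>

lemma norm_centered_dual_step_le:
  fixes q \<rho> :: "real ^ 'c::finite"
  assumes q: "q \<in> prob_simplex" and \<delta>: "0 < \<delta>" "\<And>j. \<delta> \<le> q $ j"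
    and \<alpha>: "0 \<le> \<alpha>" "\<alpha> \<le> 1" and s: "0 \<le> s" "s \<le> c" and \<rho>: "\<rho> \<in> dual_vars"
    and bound: "norm (centered \<rho>) \<le> spread_bound CARD('c) c \<delta>"
  shows "norm (centered (dual_step \<alpha> s (primal_step q \<rho>) \<rho>)) \<le> spread_bound CARD('c) c \<delta>"
proof -
  let ?p = "primal_step q \<rho>" and ?\<rho> = "dual_step \<alpha> s (primal_step q \<rho>) \<rho>"
  have "0 < q $ j" for j using \<delta>(1) \<delta>(2)[of j] by linarith
  then have p: "?p \<in> prob_simplex" by (rule primal_step_in_simplex)
  \<comment> \<open>The constant vector of the old mean lies in the orthant, so it is an admissible
    reference point for the projection.\<close>
  have m: "vec (mean \<rho>) \<in> (dual_vars :: (real ^ 'c) set)"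
    using \<rho> by (auto simp: dual_vars_def mean_def intro!: divide_nonneg_nonneg sum_nonneg)
  show ?thesis
  proof (cases "norm (centered \<rho>) \<le> 2 * real CARD('c) * (2 * c - ln \<delta>)")
    case True
    have "norm (centered ?\<rho>) \<le> norm (?\<rho> - vec (mean \<rho>))" by (rule norm_centered_le)
    also have "\<dots> \<le> norm (centered \<rho> - s *\<^sub>R excess \<alpha> ?p)"
      using norm_dual_step_diff_le[OF m] by (simp add: centered_def)
    also have "\<dots> \<le> norm (centered \<rho>) + s * norm (excess \<alpha> ?p)"
      using norm_triangle_ineq4[of "centered \<rho>" "s *\<^sub>R excess \<alpha> ?p"] s(1) by simp
    also have "s * norm (excess \<alpha> ?p) \<le> c * 2"
      using s norm_excess_le[OF p \<alpha>] by (intro mult_mono) auto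
    finally show ?thesis using True by (simp add: spread_bound_def)
  next
    case False
    then have "2 * c - ln \<delta> < norm (centered \<rho>) / (2 * real CARD('c))"
      by (simp add: less_divide_eq mult.commute)
    \<comment> \<open>Exactly what makes the linear term absorb \<open>4 * s\<^sup>2\<close> in the
      one-step inequality.\<close>
    then have "2 * s \<le> centered \<rho> \<bullet> excess \<alpha> ?p"
      using centered_inner_excess_ge[OF q \<delta>, of \<rho> \<alpha>] s(2) by linarith
    then have "2 * s * (2 * s) \<le> 2 * s * (centered \<rho> \<bullet> excess \<alpha> ?p)"
      using s(1) by (intro mult_left_mono) auto
    then have "(norm (?\<rho> - vec (mean \<rho>)))\<^sup>2 \<le> (norm (centered \<rho>))\<^sup>2"
      using power2_norm_dual_step_diff_le[OF m p \<alpha>, of s \<rho>]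
      by (simp add: power2_eq_square flip: centered_def)
    then have "norm (?\<rho> - vec (mean \<rho>)) \<le> norm (centered \<rho>)" by (rule power2_le_imp_le) simp
    then show ?thesis using norm_centered_le[of ?\<rho> "mean \<rho>"] bound by linarith
  qed
qed

lemma mean_dual_step_le:
  fixes p \<rho> :: "real ^ 'c::finite"
  assumes "p \<in> prob_simplex" "\<alpha> \<le> 1" "0 \<le> s" "mean \<rho> \<le> b"
    and spread: "norm (centered (dual_step \<alpha> s p \<rho>)) \<le> b"
  shows "mean (dual_step \<alpha> s p \<rho>) \<le> b"
proof (cases "\<exists>j. dual_step \<alpha> s p \<rho> $ j = 0")
  case True
  then show ?thesis using mean_le_norm_centered spread by (metis order_trans)
next
  case False
  \<comment> \<open>No coordinate vanishes, so every maximum is attained by its second argument: the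
    projection is inactive.\<close>
  then have "dual_step \<alpha> s p \<rho> $ j = \<rho> $ j - s * excess \<alpha> p $ j" for j
    using dual_step_component[of \<alpha> s p \<rho> j] by (metis max_def)
  then have "(\<Sum>j\<in>UNIV. dual_step \<alpha> s p \<rho> $ j) = (\<Sum>j\<in>UNIV. \<rho> $ j) - s * (1 - \<alpha>)"
    using sum_excess[OF assms(1), of \<alpha>] by (simp add: sum_subtractf flip: sum_distrib_left)
  also have "\<dots> \<le> (\<Sum>j\<in>UNIV. \<rho> $ j)" using assms(2,3) by simp
  finally have "mean (dual_step \<alpha> s p \<rho>) \<le> mean \<rho>" by (simp add: mean_def divide_right_mono)
  then show ?thesis using assms(4) by linarith
qed

lemma dual_iter_in_dual_vars: "dual_iter \<alpha> \<eta> q i \<in> dual_vars"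
  by (cases i) (simp_all add: dual_step_in_dual_vars, simp add: dual_vars_def)

text \<open>Spread and mean are bounded together by induction: the spread bound sustains itself, and
  the mean bound uses that of the new spread.\<close>

lemma norm_dual_iter_le:
  fixes q :: "nat \<Rightarrow> real ^ 'c::finite"
  assumes q: "\<And>i. i \<in> {1..n} \<Longrightarrow> q i \<in> prob_simplex"
    and \<delta>: "0 < \<delta>" "\<delta> \<le> 1" "\<And>i j. i \<in> {1..n} \<Longrightarrow> \<delta> \<le> q i $ j"
    and \<alpha>: "0 \<le> \<alpha>" "\<alpha> \<le> 1" and \<eta>: "\<And>i. 0 \<le> \<eta> i" "\<And>i. \<eta> i \<le> c"
    and "i \<le> n"
  shows "norm (dual_iter \<alpha> \<eta> q i) \<le> real CARD('c) * spread_bound CARD('c) c \<delta>"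
proof -
  let ?b = "spread_bound CARD('c) c \<delta>"
  have "0 \<le> c" using \<eta> order_trans by blast
  moreover have "ln \<delta> \<le> 0" using \<delta>(1,2) by simp
  ultimately have b: "0 \<le> ?b"
    unfolding spread_bound_def by (intro add_nonneg_nonneg mult_nonneg_nonneg) auto
  have "norm (centered (dual_iter \<alpha> \<eta> q i)) \<le> ?b \<and> mean (dual_iter \<alpha> \<eta> q i) \<le> ?b"
    using \<open>i \<le> n\<close>
  proof (induction i)
    case 0
    have "mean (0 :: real ^ 'c) = 0" "centered (0 :: real ^ 'c) = 0"
      by (simp_all add: mean_def centered_def vec_eq_iff)
    then show ?case using b by simp
  next
    case (Suc i)
    let ?\<rho> = "dual_iter \<alpha> \<eta> q i"
    have i: "Suc i \<in> {1..n}" using Suc.prems by simp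
    have "0 < q (Suc i) $ j" for j using \<delta>(1) \<delta>(3)[OF i, of j] by linarith
    then have "primal_step (q (Suc i)) ?\<rho> \<in> prob_simplex" by (rule primal_step_in_simplex)
    moreover have "norm (centered (dual_iter \<alpha> \<eta> q (Suc i))) \<le> ?b"
      using Suc by (auto intro!: norm_centered_dual_step_le q \<delta> \<alpha> \<eta> i dual_iter_in_dual_vars)
    ultimately show ?case
      using mean_dual_step_le[OF _ \<alpha>(2) \<eta>(1)[of "Suc i"]] Suc by auto
  qed
  then have *: "mean (dual_iter \<alpha> \<eta> q i) \<le> ?b" by simp
  have "norm (dual_iter \<alpha> \<eta> q i) \<le> (\<Sum>j\<in>UNIV. \<bar>dual_iter \<alpha> \<eta> q i $ j\<bar>)"
    by (rule norm_le_l1_cart)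
  \<comment> \<open>All coordinates are nonnegative, so the absolute values disappear.\<close>
  also have "\<dots> = real CARD('c) * mean (dual_iter \<alpha> \<eta> q i)"
    using dual_iter_in_dual_vars[of \<alpha> \<eta> q i] by (simp add: mean_def dual_vars_def)
  also have "\<dots> \<le> real CARD('c) * ?b" using * by (intro mult_left_mono) auto
  finally show ?thesis .
qed

section \<open>Regret of the dual iterates\<close>

text \<open>Makes the sum of the step sizes telescope to order \<open>sqrt n\<close>.\<close>

lemma inverse_sqrt_Suc_le: "1 / (2 * sqrt (real (Suc n))) \<le> sqrt (real (Suc n)) - sqrt (real n)"
proof -
  let ?a = "sqrt (real (Suc n))" and ?b = "sqrt (real n)"
  have "2 * (?a * ?b) \<le> ?a\<^sup>2 + ?b\<^sup>2" using sum_squares_bound[of ?a ?b] by (simp add: mult.assoc)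
  then have "1 \<le> (?a - ?b) * (2 * ?a)" by (simp add: algebra_simps)
  then show ?thesis by (subst pos_divide_le_eq) auto
qed

text \<open>The regret bound of online gradient descent with steps \<open>c / sqrt i\<close> on
  linear losses, for iterates within distance \<open>D\<close> of the comparator.\<close>

lemma dual_regret_le:
  fixes q :: "nat \<Rightarrow> real ^ 'c::finite" and c :: real
  defines "\<eta> \<equiv> \<lambda>i. c / sqrt (real i)"
  assumes pos: "\<And>i j. i \<in> {1..n} \<Longrightarrow> 0 < q i $ j"
    and \<alpha>: "0 \<le> \<alpha>" "\<alpha> \<le> 1" and "0 < c" and u: "u \<in> dual_vars"
    and D: "\<And>i. i \<le> n \<Longrightarrow> norm (dual_iter \<alpha> \<eta> q i - u) \<le> D"
  shows "(\<Sum>i=1..n. (dual_iter \<alpha> \<eta> q (i - 1) - u) \<bullet> excess \<alpha> (primal_iter \<alpha> \<eta> q i))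
    \<le> (D\<^sup>2 / (2 * c) + 4 * c) * sqrt (real n)"
proof -
  let ?d = "\<lambda>i. (norm (dual_iter \<alpha> \<eta> q i - u))\<^sup>2"
  have d: "?d i \<le> D\<^sup>2" if "i \<le> n" for i using D[OF that] by (intro power_mono) auto
  \<comment> \<open>Retaining \<open>- ?d m\<close> strengthens the claim enough for induction and
    replaces summation by parts: as \<open>D\<^sup>2 - ?d m\<close> is nonnegative, its weight may
    grow from \<open>sqrt m\<close> to \<open>sqrt (m + 1)\<close>.\<close>
  have partial: "(\<Sum>i=1..m. (dual_iter \<alpha> \<eta> q (i - 1) - u) \<bullet> excess \<alpha> (primal_iter \<alpha> \<eta> q i))
      \<le> (D\<^sup>2 - ?d m) / (2 * c) * sqrt (real m) + 4 * c * sqrt (real m)" if "m \<le> n" for m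
    using that
  proof (induction m)
    case 0
    then show ?case by simp
  next
    case (Suc m)
    let ?a = "sqrt (real (Suc m))" and ?b = "sqrt (real m)"
    let ?p = "primal_iter \<alpha> \<eta> q (Suc m)" and ?\<rho> = "dual_iter \<alpha> \<eta> q m"
    let ?g = "(?\<rho> - u) \<bullet> excess \<alpha> ?p"
    define s where "s = \<eta> (Suc m)"
    have s: "0 < s" "1 / s = ?a / c" using \<open>0 < c\<close> by (simp_all add: s_def \<eta>_def)
    have p: "?p \<in> prob_simplex"
      unfolding primal_iter_def using Suc.prems by (intro primal_step_in_simplex pos) auto
    have "?d (Suc m) \<le> ?d m - 2 * s * ?g + 4 * s\<^sup>2"
      using power2_norm_dual_step_diff_le[OF u p \<alpha>, of s ?\<rho>] by (simp add: primal_iter_def s_def)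
    then have "?g \<le> (?d m - ?d (Suc m)) / 2 * (1 / s) + 2 * s"
      using \<open>0 < s\<close> by (simp add: field_simps power2_eq_square)
    also have "\<dots> = (?d m - ?d (Suc m)) / (2 * c) * ?a + 2 * s" by (simp add: s(2))
    also have "2 * s = 4 * c * (1 / (2 * ?a))" by (simp add: s_def \<eta>_def)
    also have "\<dots> \<le> 4 * c * (?a - ?b)"
      using inverse_sqrt_Suc_le[of m] \<open>0 < c\<close> by (intro mult_left_mono) auto
    finally have "?g \<le> (?d m - ?d (Suc m)) / (2 * c) * ?a + 4 * c * (?a - ?b)" by simp
    moreover have "(D\<^sup>2 - ?d m) / (2 * c) * ?b \<le> (D\<^sup>2 - ?d m) / (2 * c) * ?a"
      using d[of m] Suc.prems \<open>0 < c\<close> by (intro mult_left_mono) auto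
    moreover have "(D\<^sup>2 - ?d m) / (2 * c) * ?a + (?d m - ?d (Suc m)) / (2 * c) * ?a
        = (D\<^sup>2 - ?d (Suc m)) / (2 * c) * ?a"
      by (simp add: diff_divide_distrib algebra_simps)
    ultimately show ?case using Suc by (simp add: right_diff_distrib)
  qed
  have "(\<Sum>i=1..n. (dual_iter \<alpha> \<eta> q (i - 1) - u) \<bullet> excess \<alpha> (primal_iter \<alpha> \<eta> q i))
      \<le> (D\<^sup>2 - ?d n) / (2 * c) * sqrt (real n) + 4 * c * sqrt (real n)" by (rule partial) simp
  also have "\<dots> \<le> D\<^sup>2 / (2 * c) * sqrt (real n) + 4 * c * sqrt (real n)"
    using \<open>0 < c\<close> by (intro add_right_mono mult_right_mono divide_right_mono) auto
  finally show ?thesis by (simp add: distrib_right)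
qed

section \<open>The duality gap\<close>

text \<open>The minimisation decouples over the images, and each primal iterate minimises its own
  summand.\<close>

lemma min_lagrangian_ge:
  fixes q :: "nat \<Rightarrow> real ^ 'c::finite"
  assumes pos: "\<And>i j. i \<in> {1..n} \<Longrightarrow> 0 < q i $ j"
  shows "ereal (\<Sum>i=1..n. lagrangian \<alpha> (q i) (dual_iter \<alpha> \<eta> q (i - 1)) (primal_iter \<alpha> \<eta> q i))
    \<le> min_lagrangian \<alpha> \<eta> q n"
  unfolding min_lagrangian_def primal_iter_def
  by (intro INF_greatest) (auto intro!: sum_mono lagrangian_primal_step_le pos)

lemma duality_gap_le:
  fixes q :: "nat \<Rightarrow> real ^ 'c::finite" and c :: real
  defines "\<eta> \<equiv> \<lambda>i. c / sqrt (real i)"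
  assumes "n \<ge> 1" and pos: "\<And>i j. i \<in> {1..n} \<Longrightarrow> 0 < q i $ j"
    and \<alpha>: "0 \<le> \<alpha>" "\<alpha> \<le> 1" and "0 < c" and S: "S \<subseteq> dual_vars"
    and D: "\<And>i u. i \<le> n \<Longrightarrow> u \<in> S \<Longrightarrow> norm (dual_iter \<alpha> \<eta> q i - u) \<le> D"
  shows "ereal (1 / real n) * (max_lagrangian \<alpha> \<eta> q n S - min_lagrangian \<alpha> \<eta> q n)
    \<le> ereal ((D\<^sup>2 / (2 * c) + 4 * c) / sqrt (real n))"
proof -
  define K where "K = D\<^sup>2 / (2 * c) + 4 * c"
  define m where
    "m = (\<Sum>i=1..n. lagrangian \<alpha> (q i) (dual_iter \<alpha> \<eta> q (i - 1)) (primal_iter \<alpha> \<eta> q i))"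
  have "(\<Sum>i=1..n. lagrangian \<alpha> (q i) u (primal_iter \<alpha> \<eta> q i)) \<le> m + K * sqrt (real n)"
    if "u \<in> S" for u
  proof -
    \<comment> \<open>Both sums are evaluated at the same primal iterates, so the divergences cancel
      and the regret remains.\<close>
    have "(\<Sum>i=1..n. lagrangian \<alpha> (q i) u (primal_iter \<alpha> \<eta> q i)) - m
      = (\<Sum>i=1..n. (dual_iter \<alpha> \<eta> q (i - 1) - u) \<bullet> excess \<alpha> (primal_iter \<alpha> \<eta> q i))"
      by (simp add: m_def lagrangian_eq inner_diff_left flip: sum_subtractf)
    also have "\<dots> \<le> K * sqrt (real n)"
      unfolding K_def \<eta>_def using S that pos \<alpha> \<open>0 < c\<close> D[unfolded \<eta>_def]
      by (intro dual_regret_le) auto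
    finally show ?thesis by simp
  qed
  then have "max_lagrangian \<alpha> \<eta> q n S \<le> ereal (m + K * sqrt (real n))"
    unfolding max_lagrangian_def by (intro SUP_least) auto
  then have "max_lagrangian \<alpha> \<eta> q n S - min_lagrangian \<alpha> \<eta> q n
      \<le> ereal (m + K * sqrt (real n)) - ereal m"
    using min_lagrangian_ge[OF pos, where \<alpha>=\<alpha> and \<eta>=\<eta>] unfolding m_def by (intro ereal_minus_mono) auto
  then have "ereal (1 / real n) * (max_lagrangian \<alpha> \<eta> q n S - min_lagrangian \<alpha> \<eta> q n)
      \<le> ereal (1 / real n) * ereal (K * sqrt (real n))"
    by (intro ereal_mult_left_mono) auto
  also have "\<dots> = ereal (K / sqrt (real n))"
    using \<open>n \<ge> 1\<close> by (simp add: field_simps)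
  finally show ?thesis by (simp add: K_def)
qed

text \<open>An affine function bounded above on a cone has nonpositive linear part there, so its
  maximum is at the apex 0.\<close>

lemma max_lagrangian_dual_vars_finite:
  assumes "max_lagrangian \<alpha> \<eta> q n dual_vars < \<infinity>"
  shows "max_lagrangian \<alpha> \<eta> q n dual_vars \<le> max_lagrangian \<alpha> \<eta> q n {0}"
proof -
  let ?f = "\<lambda>u. \<Sum>i=1..n. lagrangian \<alpha> (q i) u (primal_iter \<alpha> \<eta> q i)"
  define g where "g = (\<Sum>i=1..n. excess \<alpha> (primal_iter \<alpha> \<eta> q i))"
  have f: "?f u = ?f 0 - u \<bullet> g" for u
    by (simp add: lagrangian_eq g_def inner_sum_right sum_subtractf)
  have ge: "ereal (?f u) \<le> max_lagrangian \<alpha> \<eta> q n dual_vars" if "u \<in> dual_vars" for u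
    unfolding max_lagrangian_def using that by (intro SUP_upper)
  have zero: "0 \<in> dual_vars" by (simp add: dual_vars_def)
  from assms ge[OF zero] obtain r where r: "max_lagrangian \<alpha> \<eta> q n dual_vars = ereal r"
    by (cases "max_lagrangian \<alpha> \<eta> q n dual_vars") auto
  have "0 \<le> u \<bullet> g" if u: "u \<in> dual_vars" for u
  proof (rule ccontr)
    assume neg: "\<not> 0 \<le> u \<bullet> g"
    \<comment> \<open>Chosen so that the value at \<open>t *\<^sub>R u\<close> would be
      \<open>r + 1\<close>, above the supremum \<open>r\<close>.\<close>
    define t where "t = (r - ?f 0 + 1) / - (u \<bullet> g)"
    have "?f 0 \<le> r" using ge[OF zero] r by simp
    then have "0 \<le> t" unfolding t_def using neg by (intro divide_nonneg_nonneg) auto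
    then have "t *\<^sub>R u \<in> dual_vars" using u by (simp add: dual_vars_def)
    from ge[OF this] have "?f 0 - t * (u \<bullet> g) \<le> r" using f[of "t *\<^sub>R u"] r by simp
    moreover have "- (t * (u \<bullet> g)) = r - ?f 0 + 1" using neg by (simp add: t_def)
    ultimately show False by simp
  qed
  then have "?f u \<le> ?f 0" if "u \<in> dual_vars" for u
    unfolding f[of u] using that by simp
  then have "max_lagrangian \<alpha> \<eta> q n dual_vars \<le> ereal (?f 0)"
    unfolding max_lagrangian_def by (intro SUP_least) (simp only: ereal_less_eq)
  then show ?thesis by (simp add: max_lagrangian_def)
qed

section \<open>Class probabilities of bounded features, and the convergence rate\<close>

lemma class_probs_in_simplex: "class_probs z \<tau> v \<in> prob_simplex"
proof -
  have "0 < (\<Sum>k\<in>UNIV. exp ((v \<bullet> z k) / \<tau>))" by (intro sum_pos) auto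
  then show ?thesis
    by (auto simp: class_probs_def prob_simplex_def less_imp_le simp flip: sum_divide_distrib)
qed

text \<open>By Cauchy-Schwarz all exponents lie in \<open>[-A, A]\<close>, so the numerator is at
  least \<open>exp (- A)\<close> and the denominator at most \<open>C * exp A\<close>.\<close>

lemma class_probs_lower_bound:
  fixes z :: "'c::finite \<Rightarrow> real ^ 'd::finite"
  assumes "\<tau> > 0"
  obtains \<delta> where "0 < \<delta>" "\<delta> \<le> 1" "\<And>v j. norm v \<le> B \<Longrightarrow> \<delta> \<le> class_probs z \<tau> v $ j"
proof -
  \<comment> \<open>The sum of norms dominates each \<open>norm (z k)\<close>; the absolute value
    keeps \<open>A\<close> nonnegative for every real \<open>B\<close>.\<close>
  define A where "A = \<bar>B\<bar> * (\<Sum>k\<in>UNIV. norm (z k)) / \<tau>"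
  define \<delta> where "\<delta> = exp (- A) / (real CARD('c) * exp A)"
  have A: "0 \<le> A" using assms by (auto simp: A_def intro!: divide_nonneg_nonneg mult_nonneg_nonneg sum_nonneg)
  have "1 * 1 \<le> real CARD('c) * exp A" using A by (intro mult_mono) (auto simp: Suc_leI)
  moreover have "exp (- A) \<le> 1" using A by simp
  ultimately have "exp (- A) \<le> real CARD('c) * exp A" by linarith
  then have le_1: "\<delta> \<le> 1" by (simp add: \<delta>_def)
  have "0 < \<delta>" by (simp add: \<delta>_def)
  moreover note le_1
  moreover have "\<delta> \<le> class_probs z \<tau> v $ j" if v: "norm v \<le> B" for v j
  proof -
    have le: "\<bar>(v \<bullet> z k) / \<tau>\<bar> \<le> A" for k
    proof -
      have "\<bar>v \<bullet> z k\<bar> \<le> norm v * norm (z k)" by (rule Cauchy_Schwarz_ineq2)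
      also have "\<dots> \<le> \<bar>B\<bar> * (\<Sum>k\<in>UNIV. norm (z k))"
        using v by (intro mult_mono member_le_sum) auto
      finally show ?thesis using assms by (simp add: A_def divide_right_mono)
    qed
    have "(\<Sum>k\<in>UNIV. exp ((v \<bullet> z k) / \<tau>)) \<le> (\<Sum>k\<in>(UNIV :: 'c set). exp A)"
      by (intro sum_mono) (simp only: exp_le_cancel_iff abs_le_D1[OF le])
    moreover have "exp (- A) \<le> exp ((v \<bullet> z j) / \<tau>)"
      using abs_le_D2[OF le[of j]] by simp
    moreover have "0 < (\<Sum>k\<in>UNIV. exp ((v \<bullet> z k) / \<tau>))" by (intro sum_pos) auto
    ultimately show ?thesis by (auto simp: \<delta>_def class_probs_def intro!: frac_le)
  qed
  ultimately show ?thesis by (rule that)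
qed

text \<open>As the maximum over the whole orthant may be infinite, the rate is given over a ball of
  radius \<open>R\<close>, and over the orthant whenever the maximum is finite. \<open>K\<close> is
  fixed before the images and \<open>n\<close>, so the rate is uniform over all streams with
  features bounded by \<open>B\<close>.\<close>

theorem theorem1:
  fixes z :: "'c::finite \<Rightarrow> real ^ 'd::finite" and \<tau> \<alpha> c :: real
  assumes "\<tau> > 0" and "0 \<le> \<alpha>" and "\<alpha> \<le> 1" and "c > 0"
  shows "\<forall>B R. \<exists>K. \<forall>(x :: nat \<Rightarrow> real ^ 'd) n.
    n \<ge> 1 \<and> (\<forall>i\<in>{1..n}. norm (x i) \<le> B) \<longrightarrow>
    (let q = (\<lambda>i. class_probs z \<tau> (x i));
         \<eta> = (\<lambda>i. c / sqrt (real i))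
     in ereal (1 / real n) *
          (max_lagrangian \<alpha> \<eta> q n (dual_vars \<inter> cball 0 R) - min_lagrangian \<alpha> \<eta> q n)
          \<le> ereal (K / sqrt (real n)) \<and>
        (max_lagrangian \<alpha> \<eta> q n dual_vars < \<infinity> \<longrightarrow>
          ereal (1 / real n) *
            (max_lagrangian \<alpha> \<eta> q n dual_vars - min_lagrangian \<alpha> \<eta> q n)
            \<le> ereal (K / sqrt (real n))))"
proof (intro allI)
  fix B R :: real
  obtain \<delta> where \<delta>: "0 < \<delta>" "\<delta> \<le> 1"
    "\<And>v j. norm v \<le> B \<Longrightarrow> \<delta> \<le> class_probs z \<tau> v $ j"
    using class_probs_lower_bound[OF \<open>\<tau> > 0\<close>, where z=z and B=B] by blast
  define D where "D = real CARD('c) * spread_bound CARD('c) c \<delta> + \<bar>R\<bar>"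
  define K where "K = D\<^sup>2 / (2 * c) + 4 * c"
  define \<eta> where "\<eta> = (\<lambda>i. c / sqrt (real i))"
  \<comment> \<open>At \<open>i = 0\<close> division by zero yields \<open>\<eta> 0 = 0\<close>,
    which satisfies both bounds.\<close>
  have \<eta>: "0 \<le> \<eta> i" "\<eta> i \<le> c" for i
    using \<open>c > 0\<close> by (cases i; simp add: \<eta>_def divide_le_eq)+
  \<comment> \<open>Stated for a general \<open>S\<close>, to be used for the ball and for
    \<open>{0}\<close>.\<close>
  have gap: "ereal (1 / real n) *
      (max_lagrangian \<alpha> \<eta> (\<lambda>i. class_probs z \<tau> (x i)) n S
        - min_lagrangian \<alpha> \<eta> (\<lambda>i. class_probs z \<tau> (x i)) n) \<le> ereal (K / sqrt (real n))"
    if n: "n \<ge> 1" and x: "\<forall>i\<in>{1..n}. norm (x i) \<le> B" and S: "S \<subseteq> dual_vars \<inter> cball 0 \<bar>R\<bar>"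
    for x :: "nat \<Rightarrow> real ^ 'd" and n S
  proof -
    let ?q = "\<lambda>i. class_probs z \<tau> (x i)"
    have q: "\<delta> \<le> ?q i $ j" if "i \<in> {1..n}" for i j using x \<delta>(3) that by blast
    have pos: "0 < ?q i $ j" if "i \<in> {1..n}" for i j using q[OF that, of j] \<delta>(1) by linarith
    have "norm (dual_iter \<alpha> \<eta> ?q i - u) \<le> D" if "i \<le> n" "u \<in> S" for i u
    proof -
      have "norm (dual_iter \<alpha> \<eta> ?q i) \<le> real CARD('c) * spread_bound CARD('c) c \<delta>"
        by (rule norm_dual_iter_le[OF class_probs_in_simplex \<delta>(1,2) q assms(2,3) \<eta> \<open>i \<le> n\<close>])
      moreover have "norm u \<le> \<bar>R\<bar>" using S that by auto
      ultimately show ?thesis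
        using norm_triangle_ineq4[of "dual_iter \<alpha> \<eta> ?q i" u] unfolding D_def by linarith
    qed
    then show ?thesis
      unfolding K_def \<eta>_def using S
      by (intro duality_gap_le n pos assms) auto
  qed
  have "ereal (1 / real n) *
      (max_lagrangian \<alpha> \<eta> (\<lambda>i. class_probs z \<tau> (x i)) n dual_vars
        - min_lagrangian \<alpha> \<eta> (\<lambda>i. class_probs z \<tau> (x i)) n) \<le> ereal (K / sqrt (real n))"
    if n: "n \<ge> 1" and x: "\<forall>i\<in>{1..n}. norm (x i) \<le> B"
      and fin: "max_lagrangian \<alpha> \<eta> (\<lambda>i. class_probs z \<tau> (x i)) n dual_vars < \<infinity>"
    for x :: "nat \<Rightarrow> real ^ 'd" and n
  \<comment> \<open>A finite maximum over the orthant is at most the one over \<open>{0}\<close>,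
    and 0 lies in the ball of radius \<open>\<bar>R\<bar>\<close>.\<close>
  proof (rule order_trans[OF _ gap[OF n x, of "{0}"]])
    show "{0} \<subseteq> dual_vars \<inter> cball (0 :: real ^ 'c) \<bar>R\<bar>" by (simp add: dual_vars_def)
  qed (intro ereal_mult_left_mono ereal_minus_mono max_lagrangian_dual_vars_finite[OF fin]; simp)
  moreover have "dual_vars \<inter> cball 0 R \<subseteq> dual_vars \<inter> cball (0 :: real ^ 'c) \<bar>R\<bar>" by auto
  ultimately show "\<exists>K. \<forall>(x :: nat \<Rightarrow> real ^ 'd) n.
    n \<ge> 1 \<and> (\<forall>i\<in>{1..n}. norm (x i) \<le> B) \<longrightarrow>
    (let q = (\<lambda>i. class_probs z \<tau> (x i));
         \<eta> = (\<lambda>i. c / sqrt (real i))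
     in ereal (1 / real n) *
          (max_lagrangian \<alpha> \<eta> q n (dual_vars \<inter> cball 0 R) - min_lagrangian \<alpha> \<eta> q n)
          \<le> ereal (K / sqrt (real n)) \<and>
        (max_lagrangian \<alpha> \<eta> q n dual_vars < \<infinity> \<longrightarrow>
          ereal (1 / real n) *
            (max_lagrangian \<alpha> \<eta> q n dual_vars - min_lagrangian \<alpha> \<eta> q n)
            \<le> ereal (K / sqrt (real n))))"
    unfolding Let_def \<eta>_def[symmetric] using gap by (intro exI[of _ K]) blast
qed

end
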